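(* Let $R$ be an irreducible root system and let $k_c\in\mathbb{R}$ be given for each root length $c$. Let $\mathcal{H}=-\Delta+\sum_c a_cU_c$, where the sum is over all root lengths, $a_c=k_c(k_c-1)$ if $c$ is the length of a non-multiplicable root, and $a_c=k_c(k_c+k_{2c}-1)$ if $R$ is non-reduced and $c$ is the length of the short roots. Let $F=\prod_c|A_c|^{k_c}$, $\rho=\sum_ck_c\rho_c$, and $$\tilde{\mathcal{H}}=-\Delta-\sum_c2k_c\nabla\log|A_c|.$$ Then, as operators on smooth functions on the fundamental alcove $A$ (with $F$ acting by multiplication), $$F\tilde{\mathcal{H}}=\mathcal{H}F-\|\rho\|^2F.$$
   Context: Let $V$ be a finite-dimensional real vector space with a positive-definite inner product $(\cdot,\cdot)$, used to identify $V$ with $V^*$; $\Delta$ and $\nabla$ are the corresponding Laplacian and gradient. For a smooth function $f$, the vector field $\nabla f$ acts as a differential operator by $\phi\mapsto(\nabla f,\nabla\phi)$. For nonzero $\alpha\in V^*$ put $\breve\alpha=2\alpha/(\alpha,\alpha)$ and $s_\alpha(\beta)=\beta-(\breve\alpha,\beta)\alpha$. A root system is a finite spanning subset $R\subset V^*$ with $0\notin R$, $s_\alpha(R)\subset R$ and $(\breve\alpha,\beta)\in\mathbb{Z}$ for all $\alpha,\beta\in R$. It is reduced if the only roots proportional to a root $\alpha$ are $\pm\alpha$; an irreducible non-reduced one is of type $BC_n$, with short roots $\pm\epsilon_i$, medium roots $\pm\epsilon_i\pm\epsilon_j$ ($i\ne j$) and long roots $\pm2\epsilon_i$. A root $\alpha\in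 R$ is non-multiplicable if $2\alpha\notin R$. Fix an open Weyl chamber $C$; $R^+$ is the set of roots having positive inner product with all elements of $C$. A root length is a number $c=\|\alpha\|$ with $\alpha\in R$; $R_c^+=\{\alpha\in R^+:\|\alpha\|=c\}$. Put $$U_c=\frac{c^2}{4}\sum_{\alpha\in R_c^+}\csc^2\frac{\alpha}{2},\quad A_c=\prod_{\alpha\in R_c^+}\sin\frac{\alpha}{2},\quad \rho_c=\frac12\sum_{\alpha\in R_c^+}\alpha.$$ Elements of $V^*$ are viewed as linear functions on $V$. The fundamental alcove $A\subset V$ is the connected component of $V\setminus\bigcup_{\alpha\in R}\{u:\alpha(u)\in2\pi\mathbb{Z}\}$ contained in $C$ (under $V\cong V^*$) with the origin as a boundary point.
   Formalization: For non-reduced R and c the length of the short roots, the coefficient is taken as a_c = k_c(k_c + 2k_{2c} − 1) instead of k_c(k_c + k_{2c} − 1), since the printed formula fails, e.g. for BC_1 with both k equal to 1. *)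

theory Defs
  imports "HOL-Analysis.Analysis"
begin

section \<open>Smooth functions, gradient and Laplacian\<close>

text \<open>Only the values of \<open>f\<close> on \<open>S\<close> matter when \<open>S\<close> is open, which is the only case used.\<close>

fun C_k_on :: "nat \<Rightarrow> ('a::euclidean_space \<Rightarrow> real) \<Rightarrow> 'a set \<Rightarrow> bool" where
  "C_k_on 0 f S \<longleftrightarrow> continuous_on S f"
| "C_k_on (Suc n) f S \<longleftrightarrow>
     (\<forall>x\<in>S. f differentiable (at x)) \<and>
     (\<forall>v. C_k_on n (\<lambda>x. frechet_derivative f (at x) v) S)"

definition smooth_on :: "('a::euclidean_space \<Rightarrow> real) \<Rightarrow> 'a set \<Rightarrow> bool" where
  "smooth_on f S \<longleftrightarrow> (\<forall>n. C_k_on n f S)"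

definition gradient :: "('a::euclidean_space \<Rightarrow> real) \<Rightarrow> 'a \<Rightarrow> 'a" where
  "gradient f x = (THE D. GDERIV f x :> D)"

text \<open>The divergence of the gradient, i.e. the trace of the derivative of \<open>gradient f\<close>
  in an orthonormal basis.\<close>

definition laplacian :: "('a::euclidean_space \<Rightarrow> real) \<Rightarrow> 'a \<Rightarrow> real" where
  "laplacian f x = (\<Sum>b\<in>Basis. frechet_derivative (gradient f) (at x) b \<bullet> b)"


section \<open>Root systems\<close>

text \<open>The inner product identifies the space with its dual: a root \<open>\<alpha>\<close> is a vector, and as a
  linear function it is \<open>\<lambda>u. \<alpha> \<bullet> u\<close>.\<close>

definition coroot :: "'a::euclidean_space \<Rightarrow> 'a" where
  "coroot \<alpha> = (2 / (\<alpha> \<bullet> \<alpha>)) *\<^sub>R \<alpha>"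

definition root_reflection :: "'a::euclidean_space \<Rightarrow> 'a \<Rightarrow> 'a" where
  "root_reflection \<alpha> \<beta> = \<beta> - (coroot \<alpha> \<bullet> \<beta>) *\<^sub>R \<alpha>"

definition root_system :: "'a::euclidean_space set \<Rightarrow> bool" where
  "root_system R \<longleftrightarrow>
     finite R \<and> span R = UNIV \<and> 0 \<notin> R \<and>
     (\<forall>\<alpha>\<in>R. root_reflection \<alpha> ` R \<subseteq> R) \<and>
     (\<forall>\<alpha>\<in>R. \<forall>\<beta>\<in>R. coroot \<alpha> \<bullet> \<beta> \<in> \<int>)"

definition irreducible_roots :: "'a::euclidean_space set \<Rightarrow> bool" where
  "irreducible_roots R \<longleftrightarrow>
     R \<noteq> {} \<and>
     \<not> (\<exists>R1 R2. R1 \<noteq> {} \<and> R2 \<noteq> {} \<and> R1 \<inter> R2 = {} \<and> R1 \<union> R2 = R \<and>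
          (\<forall>\<alpha>\<in>R1. \<forall>\<beta>\<in>R2. \<alpha> \<bullet> \<beta> = 0))"

definition reduced_roots :: "'a::euclidean_space set \<Rightarrow> bool" where
  "reduced_roots R \<longleftrightarrow> (\<forall>\<alpha>\<in>R. \<forall>t. t *\<^sub>R \<alpha> \<in> R \<longrightarrow> t *\<^sub>R \<alpha> = \<alpha> \<or> t *\<^sub>R \<alpha> = - \<alpha>)"

definition non_multiplicable :: "'a::euclidean_space set \<Rightarrow> 'a \<Rightarrow> bool" where
  "non_multiplicable R \<alpha> \<longleftrightarrow> \<alpha> \<in> R \<and> 2 *\<^sub>R \<alpha> \<notin> R"

definition root_lengths :: "'a::euclidean_space set \<Rightarrow> real set" where
  "root_lengths R = norm ` R"

text \<open>In type \<open>BC\<^sub>n\<close> the short roots \<open>\<plusminus>\<epsilon>\<^sub>i\<close> are the roots of least length.\<close>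

definition short_length :: "'a::euclidean_space set \<Rightarrow> real" where
  "short_length R = Min (root_lengths R)"

definition weyl_chamber :: "'a::euclidean_space set \<Rightarrow> 'a set \<Rightarrow> bool" where
  "weyl_chamber R C \<longleftrightarrow> C \<in> components (UNIV - (\<Union>\<alpha>\<in>R. {u. \<alpha> \<bullet> u = 0}))"

definition fundamental_alcove :: "'a::euclidean_space set \<Rightarrow> 'a set \<Rightarrow> 'a set \<Rightarrow> bool" where
  "fundamental_alcove R C A \<longleftrightarrow>
     A \<in> components (UNIV - (\<Union>\<alpha>\<in>R. {u. \<exists>m::int. \<alpha> \<bullet> u = 2 * pi * of_int m})) \<and>
     A \<subseteq> C \<and> 0 \<in> frontier A"

definition positive_roots :: "'a::euclidean_space set \<Rightarrow> 'a set \<Rightarrow> 'a set" where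
  "positive_roots R C = {\<alpha>\<in>R. \<forall>u\<in>C. \<alpha> \<bullet> u > 0}"

definition positive_roots_of_length ::
    "'a::euclidean_space set \<Rightarrow> 'a set \<Rightarrow> real \<Rightarrow> 'a set" where
  "positive_roots_of_length R C c = {\<alpha> \<in> positive_roots R C. norm \<alpha> = c}"


section \<open>The two differential operators\<close>

definition U_fun :: "'a::euclidean_space set \<Rightarrow> 'a set \<Rightarrow> real \<Rightarrow> 'a \<Rightarrow> real" where
  "U_fun R C c u =
     c\<^sup>2 / 4 * (\<Sum>\<alpha>\<in>positive_roots_of_length R C c. 1 / (sin ((\<alpha> \<bullet> u) / 2))\<^sup>2)"

definition A_fun :: "'a::euclidean_space set \<Rightarrow> 'a set \<Rightarrow> real \<Rightarrow> 'a \<Rightarrow> real" where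
  "A_fun R C c u = (\<Prod>\<alpha>\<in>positive_roots_of_length R C c. sin ((\<alpha> \<bullet> u) / 2))"

definition rho_length :: "'a::euclidean_space set \<Rightarrow> 'a set \<Rightarrow> real \<Rightarrow> 'a" where
  "rho_length R C c = (1 / 2) *\<^sub>R (\<Sum>\<alpha>\<in>positive_roots_of_length R C c. \<alpha>)"

definition rho :: "'a::euclidean_space set \<Rightarrow> 'a set \<Rightarrow> (real \<Rightarrow> real) \<Rightarrow> 'a" where
  "rho R C k = (\<Sum>c\<in>root_lengths R. k c *\<^sub>R rho_length R C c)"

definition F_fun ::
    "'a::euclidean_space set \<Rightarrow> 'a set \<Rightarrow> (real \<Rightarrow> real) \<Rightarrow> 'a \<Rightarrow> real" where
  "F_fun R C k u = (\<Prod>c\<in>root_lengths R. \<bar>A_fun R C c u\<bar> powr k c)"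

text \<open>The coupling constants \<open>a\<close> are the usual
  \<open>k\<^sub>\<alpha> (k\<^sub>\<alpha> + 2 k\<^sub>2\<^sub>\<alpha> - 1)\<close>, with \<open>k\<^sub>2\<^sub>\<alpha> = 0\<close> if \<open>2\<alpha>\<close> is not a root. The source prints
  \<open>k\<^sub>c (k\<^sub>c + k\<^sub>2\<^sub>c - 1)\<close> for the short roots of \<open>BC\<^sub>n\<close>; without the factor 2 the conjugation identity
  fails: for \<open>BC\<^sub>1 = {\<plusminus>1, \<plusminus>2}\<close> with both \<open>k\<close> equal to 1 one has \<open>F u = sin (u/2) * sin u\<close> on
  \<open>0 < u < \<pi>\<close> and \<open>F'' u + 9/4 * F u = cos (u/2) = F u / (2 * (sin (u/2))\<^sup>2)\<close>, which forces
  \<open>a 1 = 2\<close> and not 1.\<close>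

definition H_op ::
    "'a::euclidean_space set \<Rightarrow> 'a set \<Rightarrow> (real \<Rightarrow> real) \<Rightarrow> ('a \<Rightarrow> real) \<Rightarrow> 'a \<Rightarrow> real" where
  "H_op R C a \<phi> u = - laplacian \<phi> u + (\<Sum>c\<in>root_lengths R. a c * U_fun R C c u) * \<phi> u"

definition H_tilde_op ::
    "'a::euclidean_space set \<Rightarrow> 'a set \<Rightarrow> (real \<Rightarrow> real) \<Rightarrow> ('a \<Rightarrow> real) \<Rightarrow> 'a \<Rightarrow> real" where
  "H_tilde_op R C k \<phi> u =
     - laplacian \<phi> u -
     (\<Sum>c\<in>root_lengths R.
        2 * k c * (gradient (\<lambda>v. ln \<bar>A_fun R C c v\<bar>) u \<bullet> gradient \<phi> u))"

end

theory Submission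
  imports Defs
begin

text \<open>Writing \<open>F = exp L\<close>, the claim reduces to
  \<open>\<Delta>L + \<parallel>\<nabla>L\<parallel>\<^sup>2 = V - \<parallel>\<rho>\<parallel>\<^sup>2\<close>, where \<open>V\<close> is the potential and
  \<open>\<nabla>L = \<Sum> k\<^sub>\<alpha>/2 cot(\<alpha>/2) \<alpha>\<close> over the positive roots. Up to a factor 16, the sum
  \<open>\<parallel>\<nabla>L\<parallel>\<^sup>2 + \<parallel>\<rho>\<parallel>\<^sup>2\<close> is \<open>\<Sum> k\<^sub>\<alpha> k\<^sub>\<beta> (\<alpha>,\<beta>) h(\<alpha>,\<beta>)\<close> over all pairs of roots, with
  \<open>h(\<alpha>,\<beta>) = cot(\<alpha>/2) cot(\<beta>/2) + sgn \<alpha> sgn \<beta>\<close>. The constants in the addition formulas of \<open>cot\<close>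
  and \<open>sgn\<close> cancel, which leaves \<open>h(\<alpha>+\<beta>,\<alpha>) + h(\<alpha>+\<beta>,\<beta>) = h(\<alpha>,\<beta>)\<close>; this relation and
  permutations of the set of pairs with given Cartan integers make all contributions of
  non-proportional roots vanish. The pairs \<open>(\<alpha>,\<alpha>)\<close> and \<open>(\<alpha>,2\<alpha>)\<close> give the \<open>csc\<^sup>2\<close> terms.\<close>

section \<open>Multiplicable roots\<close>

lemma root_neg:
  assumes "root_system R" "\<alpha> \<in> R" shows "- \<alpha> \<in> R"
proof -
  have "root_reflection \<alpha> \<alpha> \<in> R" "\<alpha> \<bullet> \<alpha> \<noteq> 0"
    using assms by (auto simp: root_system_def)
  then show ?thesis
    by (simp add: root_reflection_def coroot_def scaleR_2)
qed

text \<open>The reflection of \<beta> in \<alpha>, with the Cartan integer given as a real number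
  \<open>m\<close> by a cleared equation, so that later uses only have to check inner
  products.\<close>

lemma root_string:
  assumes "root_system R" "\<alpha> \<in> R" "\<beta> \<in> R" "2 * (\<alpha> \<bullet> \<beta>) = m * (\<alpha> \<bullet> \<alpha>)"
  shows "\<beta> - m *\<^sub>R \<alpha> \<in> R"
proof -
  have "root_reflection \<alpha> \<beta> \<in> R" "\<alpha> \<bullet> \<alpha> \<noteq> 0"
    using assms(1-3) by (auto simp: root_system_def)
  moreover have "coroot \<alpha> \<bullet> \<beta> = m"
    using assms(4) \<open>\<alpha> \<bullet> \<alpha> \<noteq> 0\<close> by (simp add: coroot_def field_simps)
  ultimately show ?thesis by (simp add: root_reflection_def)
qed

text \<open>The product \<open>m * n\<close> is four times the squared cosine of the angle, hence at
  most 4 by Cauchy-Schwarz.\<close>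

lemma cartan_integers:
  assumes "root_system R" "\<alpha> \<in> R" "\<beta> \<in> R" "\<alpha> \<bullet> \<beta> > 0"
  obtains m n :: int where "2 * (\<alpha> \<bullet> \<beta>) = m * (\<alpha> \<bullet> \<alpha>)" "2 * (\<alpha> \<bullet> \<beta>) = n * (\<beta> \<bullet> \<beta>)"
    "m > 0" "n > 0" "m * n \<le> 4"
proof -
  have pos: "\<alpha> \<bullet> \<alpha> > 0" "\<beta> \<bullet> \<beta> > 0"
    using assms(1-3) by (auto simp: root_system_def)
  have "coroot \<alpha> \<bullet> \<beta> \<in> \<int>" "coroot \<beta> \<bullet> \<alpha> \<in> \<int>"
    using assms(1-3) by (auto simp: root_system_def)
  then obtain m n :: int where "coroot \<alpha> \<bullet> \<beta> = m" "coroot \<beta> \<bullet> \<alpha> = n"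
    by (auto elim!: Ints_cases)
  then have mn: "2 * (\<alpha> \<bullet> \<beta>) = m * (\<alpha> \<bullet> \<alpha>)" "2 * (\<alpha> \<bullet> \<beta>) = n * (\<beta> \<bullet> \<beta>)"
    using pos by (auto simp: coroot_def field_simps inner_commute)
  have mpos: "m > 0" "n > 0"
    using zero_less_mult_pos2[of "real_of_int m" "\<alpha> \<bullet> \<alpha>"]
      zero_less_mult_pos2[of "real_of_int n" "\<beta> \<bullet> \<beta>"] mn assms(4) pos by linarith+
  have "(m * n) * ((\<alpha> \<bullet> \<alpha>) * (\<beta> \<bullet> \<beta>)) = (2 * (\<alpha> \<bullet> \<beta>)) * (2 * (\<alpha> \<bullet> \<beta>))"
    unfolding mn(1) by (subst mn(1)[symmetric], subst mn(2)) simp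
  also have "\<dots> \<le> 4 * ((\<alpha> \<bullet> \<alpha>) * (\<beta> \<bullet> \<beta>))"
    using Cauchy_Schwarz_ineq[of \<alpha> \<beta>] by (simp add: power2_eq_square)
  finally have "real_of_int (m * n) \<le> 4"
    using pos by (simp add: mult_le_cancel_right)
  then have "m * n \<le> 4" by linarith
  with mn mpos that show thesis by blast
qed

text \<open>The equality case of Cauchy-Schwarz: \<open>n\<close> times the squared norm of the
  difference of the two sides expands to 0, and \<open>n\<close> is nonzero.\<close>

lemma proportional_of_cartan_integers:
  fixes \<alpha> \<beta> :: "'a::real_inner"
  assumes "2 * (\<alpha> \<bullet> \<beta>) = m * (\<alpha> \<bullet> \<alpha>)" "2 * (\<alpha> \<bullet> \<beta>) = n * (\<beta> \<bullet> \<beta>)" "m * n = 4"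
  shows "\<beta> = (m / 2) *\<^sub>R \<alpha>"
proof -
  have "n * ((\<beta> - (m / 2) *\<^sub>R \<alpha>) \<bullet> (\<beta> - (m / 2) *\<^sub>R \<alpha>)) =
      n * (\<beta> \<bullet> \<beta>) - (m * n) * (\<alpha> \<bullet> \<beta>) + (m * n) * (m * (\<alpha> \<bullet> \<alpha>)) / 4"
    by (simp add: inner_diff inner_commute algebra_simps)
  also have "\<dots> = 0" unfolding assms(3) using assms(1,2) by (simp add: inner_commute)
  finally show ?thesis using assms(3) by auto
qed

text \<open>By irreducibility every root \<open>\<gamma>\<close> is non-orthogonal to some multiplicable root \<open>\<beta>\<close> of the
  same length as \<open>\<alpha>\<close>, and the Cartan integers of \<open>\<gamma>\<close> and \<open>2\<beta>\<close> give \<open>\<parallel>\<beta>\<parallel> \<le> \<parallel>\<gamma>\<parallel>\<close>.\<close>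

lemma multiplicable_root_shortest:
  assumes R: "root_system R" "irreducible_roots R" and \<alpha>: "\<alpha> \<in> R" "2 *\<^sub>R \<alpha> \<in> R"
  shows "norm \<alpha> = short_length R"
proof -
  define M where "M = {\<beta> \<in> R. 2 *\<^sub>R \<beta> \<in> R \<and> norm \<beta> = norm \<alpha>}"
  define R1 where "R1 = {\<gamma> \<in> R. \<exists>\<beta>\<in>M. \<beta> \<bullet> \<gamma> \<noteq> 0}"
  have nz: "\<gamma> \<bullet> \<gamma> \<noteq> 0" if "\<gamma> \<in> R" for \<gamma> using that R(1) by (auto simp: root_system_def)
  \<comment> \<open>A reflection is a linear isometry that maps \<open>R\<close> into itself, so it
    preserves both the length of \<beta> and the property that its double is a root.\<close>
  have refl: "root_reflection \<gamma> \<beta> \<in> M" if "\<gamma> \<in> R" "\<beta> \<in> M" for \<gamma> \<beta>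
  proof -
    have "root_reflection \<gamma> \<beta> \<in> R" "root_reflection \<gamma> (2 *\<^sub>R \<beta>) \<in> R"
      using that R(1) by (auto simp: root_system_def M_def)
    moreover have "root_reflection \<gamma> (2 *\<^sub>R \<beta>) = 2 *\<^sub>R root_reflection \<gamma> \<beta>"
      by (simp add: root_reflection_def algebra_simps)
    moreover have "root_reflection \<gamma> \<beta> \<bullet> root_reflection \<gamma> \<beta> = \<beta> \<bullet> \<beta>"
      using nz[OF that(1)]
      by (simp add: root_reflection_def coroot_def inner_diff inner_commute field_simps)
    ultimately show ?thesis using that by (simp add: M_def norm_eq_sqrt_inner)
  qed
  \<comment> \<open>\<delta> is orthogonal to all of \<open>M\<close>, in particular to \<beta> and
    to its reflection in \<gamma>; these two differ by a nonzero multiple of \<gamma>.\<close>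
  have orth: "\<gamma> \<bullet> \<delta> = 0" if \<gamma>: "\<gamma> \<in> R1" and \<delta>: "\<delta> \<in> R - R1" for \<gamma> \<delta>
  proof -
    obtain \<beta> where b: "\<beta> \<in> M" "\<beta> \<bullet> \<gamma> \<noteq> 0" "\<gamma> \<in> R" using \<gamma> by (auto simp: R1_def)
    have "root_reflection \<gamma> \<beta> \<bullet> \<delta> = 0" "\<beta> \<bullet> \<delta> = 0"
      using refl[OF b(3,1)] \<delta> b(1) by (auto simp: R1_def)
    then have "(coroot \<gamma> \<bullet> \<beta>) * (\<gamma> \<bullet> \<delta>) = 0"
      by (simp add: root_reflection_def inner_diff)
    moreover have "coroot \<gamma> \<bullet> \<beta> \<noteq> 0"
      using b(2) nz[OF b(3)] by (simp add: coroot_def inner_commute)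
    ultimately show ?thesis by simp
  qed
  have "\<alpha> \<in> R1" using \<alpha> nz[OF \<alpha>(1)] by (auto simp: R1_def M_def)
  have "R1 \<subseteq> R" by (auto simp: R1_def)
  have "R - R1 = {}"
  proof (rule ccontr)
    assume "R - R1 \<noteq> {}"
    then have "R1 \<noteq> {} \<and> R - R1 \<noteq> {} \<and> R1 \<inter> (R - R1) = {} \<and> R1 \<union> (R - R1) = R \<and>
        (\<forall>\<alpha>\<in>R1. \<forall>\<beta>\<in>R - R1. \<alpha> \<bullet> \<beta> = 0)"
      using \<open>\<alpha> \<in> R1\<close> \<open>R1 \<subseteq> R\<close> orth by blast
    then show False using R(2) unfolding irreducible_roots_def by blast
  qed
  have "norm \<alpha> \<le> norm \<gamma>" if \<gamma>: "\<gamma> \<in> R" for \<gamma>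
  proof -
    obtain \<beta> where b: "\<beta> \<in> M" "\<beta> \<bullet> \<gamma> \<noteq> 0" using \<gamma> \<open>R - R1 = {}\<close> by (auto simp: R1_def)
    define \<gamma>' where "\<gamma>' = (if \<beta> \<bullet> \<gamma> > 0 then \<gamma> else - \<gamma>)"
    have "\<gamma>' \<in> R" "\<gamma>' \<bullet> (2 *\<^sub>R \<beta>) > 0" "norm \<gamma>' = norm \<gamma>" "2 *\<^sub>R \<beta> \<in> R"
      using b \<gamma> root_neg[OF R(1)] by (auto simp: \<gamma>'_def M_def inner_commute)
    then obtain m n :: int where mn: "2 * (\<gamma>' \<bullet> 2 *\<^sub>R \<beta>) = m * (\<gamma>' \<bullet> \<gamma>')"
        "2 * (\<gamma>' \<bullet> 2 *\<^sub>R \<beta>) = n * (2 *\<^sub>R \<beta> \<bullet> 2 *\<^sub>R \<beta>)" "m > 0" "n > 0" "m * n \<le> 4"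
      using cartan_integers[OF R(1)] by metis
    have "m * 1 \<le> m * n" using mn by (intro mult_left_mono) auto
    then have "m \<le> 4" using mn by linarith
    \<comment> \<open>The squared length of the root \<open>2 *\<^sub>R \<beta>\<close> is
      \<open>4 * (\<beta> \<bullet> \<beta>)\<close>; the factor 4 cancels against the bound
      \<open>m \<le> 4\<close>.\<close>
    have "1 * (4 * (\<beta> \<bullet> \<beta>)) \<le> n * (4 * (\<beta> \<bullet> \<beta>))" using mn by (intro mult_right_mono) auto
    also have "\<dots> = m * (\<gamma>' \<bullet> \<gamma>')" using mn(1,2) by simp
    also have "\<dots> \<le> 4 * (\<gamma>' \<bullet> \<gamma>')" using \<open>m \<le> 4\<close> by (intro mult_right_mono) auto
    finally have "norm \<beta> \<le> norm \<gamma>'" by (simp add: norm_eq_sqrt_inner)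
    then show ?thesis using b \<open>norm \<gamma>' = norm \<gamma>\<close> by (simp add: M_def)
  qed
  moreover have "finite R" using R(1) by (simp add: root_system_def)
  ultimately show ?thesis unfolding short_length_def root_lengths_def
    using \<alpha>(1) by (intro Min_eqI[symmetric]) auto
qed

section \<open>Sums over pairs of roots\<close>

text \<open>\<open>m\<close> and \<open>n\<close> are the Cartan integers of the pair, taken as
  reals with denominators cleared. For \<open>n = 1\<close>, \<beta> is the longer root and its
  squared length is \<open>m\<close> times that of \<alpha>; the cases \<open>m = 1, 2, 3\<close>
  are the angles of 60, 45 and 30 degrees.\<close>

definition root_pairs :: "'a::euclidean_space set \<Rightarrow> real \<Rightarrow> real \<Rightarrow> ('a \<times> 'a) set" where
  "root_pairs R m n =
     {(\<alpha>, \<beta>). \<alpha> \<in> R \<and> \<beta> \<in> R \<and> 2 * (\<alpha> \<bullet> \<beta>) = m * (\<alpha> \<bullet> \<alpha>) \<and> 2 * (\<alpha> \<bullet> \<beta>) = n * (\<beta> \<bullet> \<beta>)}"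

lemma root_pairs_iff:
  "(\<alpha>, \<beta>) \<in> root_pairs R m n \<longleftrightarrow> \<alpha> \<in> R \<and> \<beta> \<in> R \<and>
     2 * (\<alpha> \<bullet> \<beta>) = m * (\<alpha> \<bullet> \<alpha>) \<and> 2 * (\<alpha> \<bullet> \<beta>) = n * (\<beta> \<bullet> \<beta>)"
  by (simp add: root_pairs_def)

lemma finite_root_pairs: "finite R \<Longrightarrow> finite (root_pairs R m n)"
  by (rule finite_subset[of _ "R \<times> R"]) (auto simp: root_pairs_def)

lemma sum_permute:
  assumes "finite P" "\<tau> ` P \<subseteq> P" "inj_on \<tau> P"
  shows "(\<Sum>p\<in>P. f (\<tau> p)) = sum f P"
  using sum.reindex[OF assms(3), of f] endo_inj_surj[OF assms] by (simp add: o_def)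

lemma sum_root_pairs_swap:
  "(\<Sum>(\<alpha>, \<beta>)\<in>root_pairs R m n. f \<alpha> \<beta>) = (\<Sum>(\<alpha>, \<beta>)\<in>root_pairs R n m. f \<beta> \<alpha>)"
  by (rule sum.reindex_bij_witness[of _ prod.swap prod.swap])
    (auto simp: root_pairs_def inner_commute)

section \<open>Cancellation over non-proportional pairs\<close>

text \<open>These relations isolate what the cancellation uses from the trigonometry.
  \<open>k\<close> depends on lengths only, so the weights below are constant on pairs with the same
  lengths and the same inner product.\<close>

locale root_kernel =
  fixes R :: "'a::euclidean_space set" and h :: "'a \<Rightarrow> 'a \<Rightarrow> real" and k :: "real \<Rightarrow> real"
  assumes R: "root_system R"
    and h_sym: "h \<alpha> \<beta> = h \<beta> \<alpha>"
    and h_odd: "h (- \<alpha>) \<beta> = - h \<alpha> \<beta>"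
    and h_add: "\<lbrakk>\<alpha> \<in> R; \<beta> \<in> R; \<alpha> + \<beta> \<in> R\<rbrakk> \<Longrightarrow> h (\<alpha> + \<beta>) \<alpha> + h (\<alpha> + \<beta>) \<beta> = h \<alpha> \<beta>"
begin

lemma finite_R: "finite R"
  using R by (simp add: root_system_def)

definition weight :: "'a \<Rightarrow> 'a \<Rightarrow> real" where
  "weight \<alpha> \<beta> = k (norm \<alpha>) * k (norm \<beta>) * (\<alpha> \<bullet> \<beta>)"

lemma weight_cong:
  assumes "\<alpha>' \<bullet> \<alpha>' = \<alpha> \<bullet> \<alpha>" "\<beta>' \<bullet> \<beta>' = \<beta> \<bullet> \<beta>" "\<alpha>' \<bullet> \<beta>' = \<alpha> \<bullet> \<beta>"
  shows "weight \<alpha>' \<beta>' = weight \<alpha> \<beta>"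
  using assms by (simp add: weight_def norm_eq_sqrt_inner)

text \<open>Since the second Cartan integer is 1, reflecting \<alpha> in \<beta> gives \<alpha> -
  \<beta>, whose negative is again a root.\<close>

lemma diff_in_R:
  assumes "(\<alpha>, \<beta>) \<in> root_pairs R m 1"
  shows "\<beta> - \<alpha> \<in> R"
  using root_string[OF R, of \<beta> \<alpha> 1] root_neg[OF R, of "\<alpha> - \<beta>"] assms
  by (auto simp: root_pairs_def inner_commute)

text \<open>The map \<open>(\<alpha>, \<beta>) \<mapsto> (\<beta>, \<beta> - \<alpha>)\<close> is rotation by 60 degrees; three consecutive terms add up
  to zero.\<close>

lemma sum_equal_length: "(\<Sum>(\<alpha>, \<beta>)\<in>root_pairs R 1 1. weight \<alpha> \<beta> * h \<alpha> \<beta>) = 0"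
proof -
  define \<tau> :: "'a \<times> 'a \<Rightarrow> 'a \<times> 'a" where "\<tau> = (\<lambda>(\<alpha>, \<beta>). (\<beta>, \<beta> - \<alpha>))"
  define f where "f = (\<lambda>(\<alpha>, \<beta>). weight \<alpha> \<beta> * h \<alpha> \<beta>)"
  let ?P = "root_pairs R 1 1"
  have fin: "finite ?P" using finite_R by (rule finite_root_pairs)
  have into: "\<tau> ` ?P \<subseteq> ?P"
    using diff_in_R[of _ _ 1] by (auto simp: \<tau>_def root_pairs_def inner_diff inner_commute)
  have inj: "inj_on \<tau> ?P" by (auto simp: \<tau>_def inj_on_def)
  have "f p + f (\<tau> p) + f (\<tau> (\<tau> p)) = 0" if p: "p \<in> ?P" for p
  proof -
    obtain \<alpha> \<beta> where p_eq: "p = (\<alpha>, \<beta>)" by (cases p)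
    have r: "\<alpha> \<in> R" "\<beta> \<in> R" "\<beta> - \<alpha> \<in> R"
      and i: "2 * (\<alpha> \<bullet> \<beta>) = \<alpha> \<bullet> \<alpha>" "2 * (\<alpha> \<bullet> \<beta>) = \<beta> \<bullet> \<beta>"
      using p diff_in_R[of \<alpha> \<beta> 1] by (auto simp: p_eq root_pairs_def)
    have "weight \<beta> (\<beta> - \<alpha>) = weight \<alpha> \<beta>" "weight (\<beta> - \<alpha>) (- \<alpha>) = weight \<alpha> \<beta>"
      using i by (auto intro!: weight_cong simp: inner_diff inner_commute)
    moreover have "f p + f (\<tau> p) + f (\<tau> (\<tau> p)) = weight \<alpha> \<beta> * h \<alpha> \<beta> +
        weight \<beta> (\<beta> - \<alpha>) * h \<beta> (\<beta> - \<alpha>) + weight (\<beta> - \<alpha>) (- \<alpha>) * h (\<beta> - \<alpha>) (- \<alpha>)"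
      by (simp add: f_def \<tau>_def p_eq)
    ultimately have "f p + f (\<tau> p) + f (\<tau> (\<tau> p)) =
        weight \<alpha> \<beta> * (h \<alpha> \<beta> + h \<beta> (\<beta> - \<alpha>) + h (\<beta> - \<alpha>) (- \<alpha>))"
      by (simp only: distrib_left)
    \<comment> \<open>The addition relation for \<beta> as the sum of \<alpha> and \<beta> -
      \<alpha>; oddness turns the third term into the negative of the right-hand side.\<close>
    moreover have "h \<alpha> \<beta> + h \<beta> (\<beta> - \<alpha>) = h \<alpha> (\<beta> - \<alpha>)"
      using h_add[of \<alpha> "\<beta> - \<alpha>"] r by (simp add: h_sym[of \<beta> \<alpha>])
    moreover have "h (\<beta> - \<alpha>) (- \<alpha>) = - h \<alpha> (\<beta> - \<alpha>)"
      using h_odd[of \<alpha> "\<beta> - \<alpha>"] h_sym[of "\<beta> - \<alpha>" "- \<alpha>"] by simp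
    ultimately show ?thesis by simp
  qed
  then have "(\<Sum>p\<in>?P. f p + f (\<tau> p) + f (\<tau> (\<tau> p))) = 0" by simp
  moreover have "(\<Sum>p\<in>?P. f (\<tau> p)) = sum f ?P" "(\<Sum>p\<in>?P. f (\<tau> (\<tau> p))) = (\<Sum>p\<in>?P. f (\<tau> p))"
    using sum_permute[OF fin into inj] sum_permute[OF fin into inj, of "f \<circ> \<tau>"] by simp_all
  ultimately show ?thesis by (simp add: sum.distrib f_def)
qed

text \<open>The long root \<beta> is the sum of the two short roots \<alpha> and \<beta> - \<alpha>.
  Exchanging these permutes the pairs, and the addition relation combines the two values of
  \<open>h\<close> into one.\<close>

lemma sum_unequal_length:
  assumes m: "m = 2 \<or> m = 3"
  shows "2 * (\<Sum>(\<alpha>, \<beta>)\<in>root_pairs R m 1. weight \<alpha> \<beta> * h \<alpha> \<beta>) =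
    (\<Sum>(\<alpha>, \<beta>)\<in>root_pairs R m 1. weight \<alpha> \<beta> * h \<alpha> (\<beta> - \<alpha>))"
proof -
  define \<tau> :: "'a \<times> 'a \<Rightarrow> 'a \<times> 'a" where "\<tau> = (\<lambda>(\<alpha>, \<beta>). (\<beta> - \<alpha>, \<beta>))"
  define f where "f = (\<lambda>(\<alpha>, \<beta>). weight \<alpha> \<beta> * h \<alpha> \<beta>)"
  define g where "g = (\<lambda>(\<alpha>, \<beta>). weight \<alpha> \<beta> * h \<alpha> (\<beta> - \<alpha>))"
  let ?P = "root_pairs R m 1"
  have fin: "finite ?P" using finite_R by (rule finite_root_pairs)
  have into: "\<tau> ` ?P \<subseteq> ?P"
    using diff_in_R[of _ _ m] m by (auto simp: \<tau>_def root_pairs_def inner_diff inner_commute)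
  have inj: "inj_on \<tau> ?P" by (auto simp: \<tau>_def inj_on_def)
  have "f p + f (\<tau> p) = g p" if p: "p \<in> ?P" for p
  proof -
    obtain \<alpha> \<beta> where p_eq: "p = (\<alpha>, \<beta>)" by (cases p)
    have r: "\<alpha> \<in> R" "\<beta> \<in> R" "\<beta> - \<alpha> \<in> R"
      and i: "2 * (\<alpha> \<bullet> \<beta>) = m * (\<alpha> \<bullet> \<alpha>)" "2 * (\<alpha> \<bullet> \<beta>) = \<beta> \<bullet> \<beta>"
      using p diff_in_R[of \<alpha> \<beta> m] by (auto simp: p_eq root_pairs_def)
    have "weight (\<beta> - \<alpha>) \<beta> = weight \<alpha> \<beta>"
      using i by (auto intro!: weight_cong simp: inner_diff inner_commute)
    moreover have "h \<alpha> \<beta> + h (\<beta> - \<alpha>) \<beta> = h \<alpha> (\<beta> - \<alpha>)"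
      using h_add[of \<alpha> "\<beta> - \<alpha>"] r h_sym by simp
    ultimately show ?thesis by (simp add: f_def g_def \<tau>_def p_eq distrib_left[symmetric])
  qed
  then have "(\<Sum>p\<in>?P. f p + f (\<tau> p)) = sum g ?P" by simp
  then show ?thesis
    using sum_permute[OF fin into inj, of f] by (simp add: sum.distrib f_def g_def)
qed

text \<open>The summand left by \<open>sum_unequal_length\<close> changes sign under reflecting \<open>\<beta>\<close> in the line of \<open>\<alpha>\<close>.\<close>

lemma sum_ratio_two: "(\<Sum>(\<alpha>, \<beta>)\<in>root_pairs R 2 1. weight \<alpha> \<beta> * h \<alpha> \<beta>) = 0"
proof -
  define \<tau> :: "'a \<times> 'a \<Rightarrow> 'a \<times> 'a" where "\<tau> = (\<lambda>(\<alpha>, \<beta>). (\<alpha>, 2 *\<^sub>R \<alpha> - \<beta>))"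
  define g where "g = (\<lambda>(\<alpha>, \<beta>). weight \<alpha> \<beta> * h \<alpha> (\<beta> - \<alpha>))"
  let ?P = "root_pairs R 2 1"
  have fin: "finite ?P" using finite_R by (rule finite_root_pairs)
  \<comment> \<open>This vector is the negative of the root reflection of \<beta> in \<alpha>,
    because the Cartan integer is 2.\<close>
  have mem: "2 *\<^sub>R \<alpha> - \<beta> \<in> R" if "(\<alpha>, \<beta>) \<in> ?P" for \<alpha> \<beta>
    using that root_string[OF R, of \<alpha> \<beta> 2] root_neg[OF R, of "\<beta> - 2 *\<^sub>R \<alpha>"]
    by (auto simp: root_pairs_def)
  have into: "\<tau> ` ?P \<subseteq> ?P"
    using mem by (auto simp: \<tau>_def root_pairs_def inner_diff inner_commute)
  have inj: "inj_on \<tau> ?P" by (auto simp: \<tau>_def inj_on_def)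
  have "g (\<tau> p) = - g p" if p: "p \<in> ?P" for p
  proof -
    obtain \<alpha> \<beta> where p_eq: "p = (\<alpha>, \<beta>)" by (cases p)
    have i: "2 * (\<alpha> \<bullet> \<beta>) = 2 * (\<alpha> \<bullet> \<alpha>)" "2 * (\<alpha> \<bullet> \<beta>) = \<beta> \<bullet> \<beta>"
      using p by (auto simp: p_eq root_pairs_def)
    have "weight \<alpha> (2 *\<^sub>R \<alpha> - \<beta>) = weight \<alpha> \<beta>"
      using i by (auto intro!: weight_cong simp: inner_diff inner_commute)
    moreover have "h \<alpha> (2 *\<^sub>R \<alpha> - \<beta> - \<alpha>) = - h \<alpha> (\<beta> - \<alpha>)"
      using h_odd[of "\<beta> - \<alpha>" \<alpha>] h_sym[of \<alpha>] by (simp add: scaleR_2)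
    ultimately show ?thesis by (simp add: g_def \<tau>_def p_eq)
  qed
  then have "(\<Sum>p\<in>?P. g (\<tau> p)) = - sum g ?P" by (simp add: sum_negf)
  then have "sum g ?P = 0" using sum_permute[OF fin into inj, of g] by simp
  then show ?thesis using sum_unequal_length[of 2] by (simp add: g_def)
qed

text \<open>Here the short roots \<open>\<alpha>\<close> and \<open>\<beta> - \<alpha>\<close> enclose 60 degrees, so the rotation argument of
  \<open>sum_equal_length\<close> applies.\<close>

lemma sum_ratio_three: "(\<Sum>(\<alpha>, \<beta>)\<in>root_pairs R 3 1. weight \<alpha> \<beta> * h \<alpha> \<beta>) = 0"
proof -
  \<comment> \<open>Rotation by 60 degrees sends \<alpha> to \<delta> = \<beta> - \<alpha> and
    \<delta> to \<delta> - \<alpha>. Hence it sends the long root \<beta> = \<alpha> + \<delta> to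
    \<open>2 *\<^sub>R \<delta> - \<alpha>\<close>, which is
    \<open>2 *\<^sub>R \<beta> - 3 *\<^sub>R \<alpha>\<close>.\<close>
  define \<tau> :: "'a \<times> 'a \<Rightarrow> 'a \<times> 'a" where
    "\<tau> = (\<lambda>(\<alpha>, \<beta>). (\<beta> - \<alpha>, 2 *\<^sub>R \<beta> - 3 *\<^sub>R \<alpha>))"
  define g where "g = (\<lambda>(\<alpha>, \<beta>). weight \<alpha> \<beta> * h \<alpha> (\<beta> - \<alpha>))"
  let ?P = "root_pairs R 3 1"
  have fin: "finite ?P" using finite_R by (rule finite_root_pairs)
  have mem1: "\<beta> - 2 *\<^sub>R \<alpha> \<in> R" if "(\<alpha>, \<beta>) \<in> ?P" for \<alpha> \<beta>
    using that root_string[OF R, of \<alpha> "\<beta> - \<alpha>" 1] diff_in_R[OF that]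
    by (auto simp: root_pairs_def inner_diff scaleR_2 algebra_simps)
  have mem2: "2 *\<^sub>R \<beta> - 3 *\<^sub>R \<alpha> \<in> R" if "(\<alpha>, \<beta>) \<in> ?P" for \<alpha> \<beta>
  proof -
    \<comment> \<open>Reflection of \<beta> in the short root \<beta> - \<alpha>, which like
      \<alpha> has Cartan integer 3 with \<beta>.\<close>
    have "\<beta> - 3 *\<^sub>R (\<beta> - \<alpha>) \<in> R"
      using that diff_in_R[OF that]
      by (intro root_string[OF R]) (auto simp: root_pairs_def inner_diff inner_commute)
    moreover have "- (\<beta> - 3 *\<^sub>R (\<beta> - \<alpha>)) = 2 *\<^sub>R \<beta> - 3 *\<^sub>R \<alpha>"
      by (rule euclidean_eqI, simp add: inner_simps)
    ultimately show ?thesis using root_neg[OF R] by metis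
  qed
  have into: "\<tau> ` ?P \<subseteq> ?P"
    using mem2 diff_in_R[of _ _ 3] by (auto simp: \<tau>_def root_pairs_def inner_diff inner_commute)
  have inj: "inj_on \<tau> ?P"
  proof (rule inj_on_inverseI)
    fix p assume "p \<in> ?P"
    \<comment> \<open>The explicit inverse is the rotation by 60 degrees in the opposite
      direction.\<close>
    show "(\<lambda>(\<gamma>, \<delta>). (2 *\<^sub>R \<gamma> - \<delta>, 3 *\<^sub>R \<gamma> - \<delta>)) (\<tau> p) = p"
      by (cases p) (auto simp: \<tau>_def intro!: euclidean_eqI[where 'a='a] simp: inner_simps)
  qed
  have "g p + g (\<tau> p) + g (\<tau> (\<tau> p)) = 0" if p: "p \<in> ?P" for p
  proof -
    obtain \<alpha> \<beta> where p_eq: "p = (\<alpha>, \<beta>)" by (cases p)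
    define \<delta> where "\<delta> = \<beta> - \<alpha>"
    have \<beta>: "\<beta> = \<alpha> + \<delta>" by (simp add: \<delta>_def)
    have r: "\<alpha> \<in> R" "\<delta> \<in> R" "\<delta> - \<alpha> \<in> R"
      and i: "\<delta> \<bullet> \<delta> = \<alpha> \<bullet> \<alpha>" "2 * (\<alpha> \<bullet> \<delta>) = \<alpha> \<bullet> \<alpha>"
      using p diff_in_R[of \<alpha> \<beta> 3] mem1[of \<alpha> \<beta>]
      by (auto simp: p_eq root_pairs_def \<beta> scaleR_2 inner_add inner_commute algebra_simps)
    have "\<tau> p = (\<delta>, 2 *\<^sub>R \<delta> - \<alpha>)"
      by (auto simp: \<tau>_def p_eq \<beta> intro!: euclidean_eqI[where 'a='a] simp: inner_simps)
    moreover have "\<tau> (\<delta>, 2 *\<^sub>R \<delta> - \<alpha>) = (\<delta> - \<alpha>, \<delta> - 2 *\<^sub>R \<alpha>)"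
      by (auto simp: \<tau>_def intro!: euclidean_eqI[where 'a='a] simp: inner_simps)
    moreover have "weight \<delta> (2 *\<^sub>R \<delta> - \<alpha>) = weight \<alpha> \<beta>" 
      "weight (\<delta> - \<alpha>) (\<delta> - 2 *\<^sub>R \<alpha>) = weight \<alpha> \<beta>"
      using i by (auto intro!: weight_cong simp: \<beta> inner_diff inner_add inner_commute)
    moreover have "2 *\<^sub>R \<delta> - \<alpha> - \<delta> = \<delta> - \<alpha>" "\<delta> - 2 *\<^sub>R \<alpha> - (\<delta> - \<alpha>) = - \<alpha>"
      by (simp_all add: scaleR_2)
    moreover have "g p = weight \<alpha> \<beta> * h \<alpha> \<delta>"
      by (simp add: g_def p_eq \<delta>_def)
    ultimately have "g p + g (\<tau> p) + g (\<tau> (\<tau> p)) =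
        weight \<alpha> \<beta> * (h \<alpha> \<delta> + h \<delta> (\<delta> - \<alpha>) + h (\<delta> - \<alpha>) (- \<alpha>))"
      by (simp only: g_def prod.case distrib_left)
    moreover have "h \<delta> \<alpha> + h \<delta> (\<delta> - \<alpha>) = h \<alpha> (\<delta> - \<alpha>)"
      using h_add[of \<alpha> "\<delta> - \<alpha>"] r by simp
    moreover have "h (\<delta> - \<alpha>) (- \<alpha>) = - h \<alpha> (\<delta> - \<alpha>)"
      using h_odd[of \<alpha> "\<delta> - \<alpha>"] h_sym[of "\<delta> - \<alpha>" "- \<alpha>"] by simp
    ultimately show ?thesis using h_sym[of \<alpha> \<delta>] by simp
  qed
  then have "(\<Sum>p\<in>?P. g p + g (\<tau> p) + g (\<tau> (\<tau> p))) = 0" by simp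
  moreover have "(\<Sum>p\<in>?P. g (\<tau> p)) = sum g ?P" "(\<Sum>p\<in>?P. g (\<tau> (\<tau> p))) = (\<Sum>p\<in>?P. g (\<tau> p))"
    using sum_permute[OF fin into inj] sum_permute[OF fin into inj, of "g \<circ> \<tau>"] by simp_all
  ultimately have "sum g ?P = 0" by (simp add: sum.distrib)
  then show ?thesis using sum_unequal_length[of 3] by (simp add: g_def)
qed

section \<open>Reduction to proportional pairs\<close>

text \<open>Acute pairs are classified by their Cartan integers; all classes but those of \<beta> =
  \<alpha> and of one root being twice the other sum to 0. The factor 2 accounts for the two orders
  in the latter case.\<close>

lemma sum_acute_pairs:
  "(\<Sum>(\<alpha>, \<beta>) | \<alpha> \<in> R \<and> \<beta> \<in> R \<and> \<alpha> \<bullet> \<beta> > 0. weight \<alpha> \<beta> * h \<alpha> \<beta>) =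
     (\<Sum>(\<alpha>, \<beta>)\<in>root_pairs R 2 2. weight \<alpha> \<beta> * h \<alpha> \<beta>) +
     2 * (\<Sum>(\<alpha>, \<beta>)\<in>root_pairs R 4 1. weight \<alpha> \<beta> * h \<alpha> \<beta>)"
proof -
  define S where "S = (\<lambda>m n. \<Sum>(\<alpha>, \<beta>)\<in>root_pairs R m n. weight \<alpha> \<beta> * h \<alpha> \<beta>)"
  \<comment> \<open>All ordered pairs of positive integers with product at most 4.\<close>
  define I :: "(real \<times> real) set" where
    "I = {(1,1), (2,1), (1,2), (3,1), (1,3), (2,2), (4,1), (1,4)}"
  have swap: "S m n = S n m" for m n
    unfolding S_def by (subst sum_root_pairs_swap) (simp add: weight_def h_sym inner_commute mult_ac)
  have nz: "\<alpha> \<bullet> \<alpha> > 0" if "\<alpha> \<in> R" for \<alpha> using that R by (auto simp: root_system_def)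
  have "{(\<alpha>, \<beta>). \<alpha> \<in> R \<and> \<beta> \<in> R \<and> \<alpha> \<bullet> \<beta> > 0} = (\<Union>i\<in>I. root_pairs R (fst i) (snd i))"
    (is "?Q = ?U")
  proof
    show "?Q \<subseteq> ?U"
    proof clarify
      fix \<alpha> \<beta> assume r: "\<alpha> \<in> R" "\<beta> \<in> R" "\<alpha> \<bullet> \<beta> > 0"
      obtain m n :: int where mn: "2 * (\<alpha> \<bullet> \<beta>) = m * (\<alpha> \<bullet> \<alpha>)"
          "2 * (\<alpha> \<bullet> \<beta>) = n * (\<beta> \<bullet> \<beta>)" "m > 0" "n > 0" "m * n \<le> 4"
        using cartan_integers[OF R r] by metis
      have "m * 1 \<le> m * n" "1 * n \<le> m * n" using mn(3,4) by (auto intro!: mult_mono)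
      then have "1 \<le> m \<and> m \<le> 4" "1 \<le> n \<and> n \<le> 4" using mn(3-5) by linarith+
      then have "m = 1 \<or> m = 2 \<or> m = 3 \<or> m = 4" "n = 1 \<or> n = 2 \<or> n = 3 \<or> n = 4"
        by presburger+
      then have "(real_of_int m, real_of_int n) \<in> I"
        using mn(5) by (elim disjE) (simp_all add: I_def)
      moreover have "(\<alpha>, \<beta>) \<in> root_pairs R m n" using r mn by (simp add: root_pairs_def)
      ultimately show "(\<alpha>, \<beta>) \<in> ?U" by force
    qed
    have "\<alpha> \<bullet> \<beta> > 0" if r: "\<alpha> \<in> R" and i: "2 * (\<alpha> \<bullet> \<beta>) = m * (\<alpha> \<bullet> \<alpha>)" "(m, n) \<in> I" for \<alpha> \<beta> m n
    proof -
      have "m > 0" using i(2) by (auto simp: I_def)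
      with nz[OF r] have "m * (\<alpha> \<bullet> \<alpha>) > 0" by simp
      with i(1) show ?thesis by linarith
    qed
    then show "?U \<subseteq> ?Q" by (force simp: root_pairs_def)
  qed
  then have "sum (\<lambda>(\<alpha>, \<beta>). weight \<alpha> \<beta> * h \<alpha> \<beta>) ?Q =
      sum (\<lambda>(\<alpha>, \<beta>). weight \<alpha> \<beta> * h \<alpha> \<beta>) ?U" by simp
  also have "\<dots> = (\<Sum>i\<in>I. S (fst i) (snd i))"
    unfolding S_def
  proof (rule sum.UNION_disjoint)
    show "finite I" by (simp add: I_def)
    show "\<forall>i\<in>I. finite (root_pairs R (fst i) (snd i))" using finite_R by (simp add: finite_root_pairs)
    show "\<forall>i\<in>I. \<forall>j\<in>I. i \<noteq> j \<longrightarrow> root_pairs R (fst i) (snd i) \<inter> root_pairs R (fst j) (snd j) = {}"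
    proof (intro ballI impI equals0I)
      fix i j p assume p: "i \<noteq> j" "p \<in> root_pairs R (fst i) (snd i) \<inter> root_pairs R (fst j) (snd j)"
      obtain \<alpha> \<beta> where "p = (\<alpha>, \<beta>)" by (cases p)
      with p(2) have r: "\<alpha> \<in> R" "\<beta> \<in> R"
        and i: "2 * (\<alpha> \<bullet> \<beta>) = fst i * (\<alpha> \<bullet> \<alpha>)" "2 * (\<alpha> \<bullet> \<beta>) = snd i * (\<beta> \<bullet> \<beta>)"
        and j: "2 * (\<alpha> \<bullet> \<beta>) = fst j * (\<alpha> \<bullet> \<alpha>)" "2 * (\<alpha> \<bullet> \<beta>) = snd j * (\<beta> \<bullet> \<beta>)"
        unfolding \<open>p = (\<alpha>, \<beta>)\<close> Int_iff root_pairs_iff by blast+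
      have "fst i = fst j" using i(1) j(1) nz[OF r(1)] by simp
      moreover have "snd i = snd j" using i(2) j(2) nz[OF r(2)] by simp
      ultimately have "i = j" by (rule prod_eqI)
      with p(1) show False ..
    qed
  qed
  also have "\<dots> = S 2 2 + 2 * S 4 1"
    using sum_equal_length sum_ratio_two sum_ratio_three swap[of 1 2] swap[of 1 3] swap[of 1 4]
    by (simp add: I_def) (simp add: S_def)
  finally show ?thesis by (simp add: S_def)
qed

text \<open>Orthogonal pairs have weight 0, and negating \<alpha> matches obtuse pairs with acute
  ones, as weight and kernel both change sign. This gives the first factor 2; the 8 contains two
  more, from the two orders of a root and its double and from their inner product
  \<open>2 * (\<alpha> \<bullet> \<alpha>)\<close>.\<close>

lemma sum_all_pairs:
  "(\<Sum>\<alpha>\<in>R. \<Sum>\<beta>\<in>R. weight \<alpha> \<beta> * h \<alpha> \<beta>) =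
     2 * (\<Sum>\<alpha>\<in>R. (k (norm \<alpha>))\<^sup>2 * (\<alpha> \<bullet> \<alpha>) * h \<alpha> \<alpha>) +
     8 * (\<Sum>\<alpha> | \<alpha> \<in> R \<and> 2 *\<^sub>R \<alpha> \<in> R. k (norm \<alpha>) * k (2 * norm \<alpha>) * (\<alpha> \<bullet> \<alpha>) * h \<alpha> (2 *\<^sub>R \<alpha>))"
proof -
  define f where "f = (\<lambda>(\<alpha>, \<beta>). weight \<alpha> \<beta> * h \<alpha> \<beta>)"
  define Q where "Q = {(\<alpha>, \<beta>). \<alpha> \<in> R \<and> \<beta> \<in> R \<and> \<alpha> \<bullet> \<beta> > 0}"
  define N where "N = {(\<alpha>, \<beta>). \<alpha> \<in> R \<and> \<beta> \<in> R \<and> \<alpha> \<bullet> \<beta> < 0}"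
  have sub: "Q \<union> N \<subseteq> R \<times> R" "Q \<inter> N = {}" by (auto simp: Q_def N_def)
  have fin: "finite (R \<times> R)" using finite_R by simp
  have "(\<Sum>\<alpha>\<in>R. \<Sum>\<beta>\<in>R. weight \<alpha> \<beta> * h \<alpha> \<beta>) = sum f (R \<times> R)"
    by (simp add: f_def sum.cartesian_product)
  also have "\<dots> = sum f (Q \<union> N)"
    by (rule sum.mono_neutral_right[OF fin sub(1)])
      (auto simp: f_def weight_def Q_def N_def neq_iff)
  also have "\<dots> = sum f Q + sum f N"
    using sub fin by (intro sum.union_disjoint) (auto intro: finite_subset)
  also have "sum f N = sum f Q"
    by (rule sum.reindex_bij_witness[of _ "\<lambda>(\<alpha>, \<beta>). (- \<alpha>, \<beta>)" "\<lambda>(\<alpha>, \<beta>). (- \<alpha>, \<beta>)"])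
      (auto simp: N_def Q_def f_def weight_def h_odd root_neg[OF R])
  also have "sum f Q = sum f (root_pairs R 2 2) + 2 * sum f (root_pairs R 4 1)"
    using sum_acute_pairs by (simp add: f_def Q_def)
  also have "sum f (root_pairs R 2 2) = (\<Sum>\<alpha>\<in>R. (k (norm \<alpha>))\<^sup>2 * (\<alpha> \<bullet> \<alpha>) * h \<alpha> \<alpha>)"
  proof (rule sum.reindex_bij_witness[of _ "\<lambda>\<alpha>. (\<alpha>, \<alpha>)" fst])
    fix p assume p: "p \<in> root_pairs R 2 2"
    then show eq: "(fst p, fst p) = p"
      using proportional_of_cartan_integers[of "fst p" "snd p" 2 2]
      by (auto simp: root_pairs_def)
    show "fst p \<in> R" using p by (auto simp: root_pairs_def)
    show "(k (norm (fst p)))\<^sup>2 * (fst p \<bullet> fst p) * h (fst p) (fst p) = f p"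
      by (subst (6) eq[symmetric]) (simp add: f_def weight_def power2_eq_square)
  qed (auto simp: root_pairs_def)
  also have "sum f (root_pairs R 4 1) = (\<Sum>\<alpha> | \<alpha> \<in> R \<and> 2 *\<^sub>R \<alpha> \<in> R.
      2 * (k (norm \<alpha>) * k (2 * norm \<alpha>) * (\<alpha> \<bullet> \<alpha>) * h \<alpha> (2 *\<^sub>R \<alpha>)))"
  proof (rule sum.reindex_bij_witness[of _ "\<lambda>\<alpha>. (\<alpha>, 2 *\<^sub>R \<alpha>)" fst])
    fix p assume p: "p \<in> root_pairs R 4 1"
    then have "snd p = 2 *\<^sub>R fst p"
      using proportional_of_cartan_integers[of "fst p" "snd p" 4 1]
      by (auto simp: root_pairs_def)
    then obtain \<alpha> where eq: "p = (\<alpha>, 2 *\<^sub>R \<alpha>)" by (metis prod.collapse)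
    show "(fst p, 2 *\<^sub>R fst p) = p" by (simp add: eq)
    show "fst p \<in> {\<alpha>. \<alpha> \<in> R \<and> 2 *\<^sub>R \<alpha> \<in> R}" using p by (auto simp: root_pairs_def eq)
    show "2 * (k (norm (fst p)) * k (2 * norm (fst p)) * (fst p \<bullet> fst p) * h (fst p) (2 *\<^sub>R fst p)) = f p"
      by (simp add: f_def weight_def eq)
  qed (auto simp: root_pairs_def)
  finally show ?thesis by (simp add: sum_distrib_left[symmetric])
qed

end

section \<open>Addition formulas and the squared norm of the logarithmic gradient\<close>

lemma cot_add_relation:
  fixes x y :: real
  assumes "sin x \<noteq> 0" "sin y \<noteq> 0" "sin (x + y) \<noteq> 0"
  shows "cot (x + y) * (cot x + cot y) = cot x * cot y - 1"
proof -
  have "cot x + cot y = sin (x + y) / (sin x * sin y)"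
    using assms by (simp add: cot_def sin_add field_simps)
  moreover have "cot x * cot y - 1 = cos (x + y) / (sin x * sin y)"
    using assms by (simp add: cot_def cos_add field_simps)
  ultimately show ?thesis using assms(3) by (simp add: cot_def)
qed

text \<open>The limit of the addition formula of the hyperbolic cotangent when both arguments are
  scaled to infinity; its constant is opposite to that of \<open>cot\<close>.\<close>

lemma sgn_add_relation:
  fixes x y :: real
  assumes "x \<noteq> 0" "y \<noteq> 0" "x + y \<noteq> 0"
  shows "sgn (x + y) * (sgn x + sgn y) = sgn x * sgn y + 1"
  using assms by (auto simp: sgn_if)

lemma sum_roots_even:
  fixes f :: "'a::euclidean_space \<Rightarrow> 'b::real_vector"
  assumes R: "root_system R" and x0: "\<And>\<alpha>. \<alpha> \<in> R \<Longrightarrow> \<alpha> \<bullet> x0 \<noteq> 0"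
    and even: "\<And>\<alpha>. \<alpha> \<in> R \<Longrightarrow> f (- \<alpha>) = f \<alpha>"
  shows "sum f R = 2 *\<^sub>R sum f {\<alpha> \<in> R. \<alpha> \<bullet> x0 > 0}"
proof -
  let ?P = "{\<alpha> \<in> R. \<alpha> \<bullet> x0 > 0}" and ?N = "{\<alpha> \<in> R. \<alpha> \<bullet> x0 < 0}"
  have "finite R" using R by (simp add: root_system_def)
  have "R = ?P \<union> ?N" using x0 by (auto simp: less_le not_le)
  then have "sum f R = sum f (?P \<union> ?N)" by simp
  also have "\<dots> = sum f ?P + sum f ?N"
    using \<open>finite R\<close> by (intro sum.union_disjoint) auto
  also have "sum f ?N = sum f ?P"
    by (rule sum.reindex_bij_witness[of _ uminus uminus]) (auto simp: root_neg[OF R] even)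
  finally show ?thesis by (simp add: scaleR_2)
qed

lemma norm_sum_scaled_squared:
  fixes S :: "'a::real_inner set"
  shows "(norm (\<Sum>\<alpha>\<in>S. c \<alpha> *\<^sub>R \<alpha>))\<^sup>2 = (\<Sum>\<alpha>\<in>S. \<Sum>\<beta>\<in>S. c \<alpha> * c \<beta> * (\<alpha> \<bullet> \<beta>))"
  by (simp add: power2_norm_eq_inner inner_sum_left inner_sum_right sum_distrib_left inner_commute mult_ac)

text \<open>Both vectors on the left become sums over all of \<open>R\<close>, since
  \<open>cot\<close> and \<open>sgn\<close> are odd like the roots themselves. The sum of the
  squared norms is then a double sum with a kernel \<open>h\<close> to which
  \<open>sum_all_pairs\<close> applies.\<close>

lemma drift_identity:
  fixes R :: "'a::euclidean_space set" and k :: "real \<Rightarrow> real"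
  assumes R: "root_system R" and x0: "\<And>\<alpha>. \<alpha> \<in> R \<Longrightarrow> \<alpha> \<bullet> x0 \<noteq> 0"
    and u: "\<And>\<alpha>. \<alpha> \<in> R \<Longrightarrow> sin ((\<alpha> \<bullet> u) / 2) \<noteq> 0"
  defines "P \<equiv> {\<alpha> \<in> R. \<alpha> \<bullet> x0 > 0}"
  shows "(norm (\<Sum>\<alpha>\<in>P. (k (norm \<alpha>) / 2 * cot ((\<alpha> \<bullet> u) / 2)) *\<^sub>R \<alpha>))\<^sup>2 +
      (norm (\<Sum>\<alpha>\<in>P. (k (norm \<alpha>) / 2) *\<^sub>R \<alpha>))\<^sup>2 =
    (\<Sum>\<alpha>\<in>P. k (norm \<alpha>) * (k (norm \<alpha>) + (if 2 *\<^sub>R \<alpha> \<in> R then 2 * k (2 * norm \<alpha>) else 0)) *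
      (norm \<alpha>)\<^sup>2 / 4 / (sin ((\<alpha> \<bullet> u) / 2))\<^sup>2)"
proof -
  define c where "c = (\<lambda>\<alpha>. cot ((\<alpha> \<bullet> u) / 2))"
  define s where "s = (\<lambda>\<alpha>. sgn (\<alpha> \<bullet> x0))"
  define h where "h = (\<lambda>\<alpha> \<beta>. c \<alpha> * c \<beta> + s \<alpha> * s \<beta>)"
  define q where "q = (\<lambda>\<alpha>. k (norm \<alpha>) *
    (k (norm \<alpha>) + (if 2 *\<^sub>R \<alpha> \<in> R then 2 * k (2 * norm \<alpha>) else 0)) *
      (norm \<alpha>)\<^sup>2 / (sin ((\<alpha> \<bullet> u) / 2))\<^sup>2)"
  have odd: "c (- \<alpha>) = - c \<alpha>" "s (- \<alpha>) = - s \<alpha>" for \<alpha>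
    by (simp_all add: c_def s_def cot_def sgn_minus)
  have "finite R" using R by (simp add: root_system_def)
  interpret root_kernel R h k
  proof
    fix \<alpha> \<beta> assume r: "\<alpha> \<in> R" "\<beta> \<in> R" "\<alpha> + \<beta> \<in> R"
    have "c (\<alpha> + \<beta>) * (c \<alpha> + c \<beta>) = c \<alpha> * c \<beta> - 1"
      using cot_add_relation[of "(\<alpha> \<bullet> u) / 2" "(\<beta> \<bullet> u) / 2"] u[OF r(1)] u[OF r(2)] u[OF r(3)]
      by (simp add: c_def inner_add_left add_divide_distrib)
    moreover have "s (\<alpha> + \<beta>) * (s \<alpha> + s \<beta>) = s \<alpha> * s \<beta> + 1"
      using sgn_add_relation[of "\<alpha> \<bullet> x0" "\<beta> \<bullet> x0"] x0[OF r(1)] x0[OF r(2)] x0[OF r(3)]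
      by (simp add: s_def inner_add_left)
    ultimately show "h (\<alpha> + \<beta>) \<alpha> + h (\<alpha> + \<beta>) \<beta> = h \<alpha> \<beta>"
      by (simp add: h_def distrib_left)
  qed (use R odd in \<open>simp_all add: h_def mult.commute\<close>)
  have diag: "h \<alpha> \<alpha> = 1 / (sin ((\<alpha> \<bullet> u) / 2))\<^sup>2" if "\<alpha> \<in> R" for \<alpha>
  proof -
    have "s \<alpha> * s \<alpha> = 1" using x0[OF that] by (simp add: s_def sgn_if)
    moreover have "c \<alpha> * c \<alpha> + 1 = 1 / (sin ((\<alpha> \<bullet> u) / 2))\<^sup>2"
      using u[OF that] sin_cos_squared_add[of "(\<alpha> \<bullet> u) / 2"]
      by (simp add: c_def cot_def field_simps power2_eq_square)
    ultimately show ?thesis by (simp add: h_def)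
  qed
  have double: "h \<alpha> (2 *\<^sub>R \<alpha>) = 1 / (2 * (sin ((\<alpha> \<bullet> u) / 2))\<^sup>2)"
    if r: "\<alpha> \<in> R" "2 *\<^sub>R \<alpha> \<in> R" for \<alpha>
  proof -
    \<comment> \<open>The addition relation with both summands equal to \<alpha>.\<close>
    have "h \<alpha> (2 *\<^sub>R \<alpha>) = h \<alpha> \<alpha> / 2"
      using h_add[of \<alpha> \<alpha>] r h_sym[of \<alpha> "2 *\<^sub>R \<alpha>"] by (simp add: scaleR_2)
    then show ?thesis using diag[OF r(1)] by simp
  qed
  \<comment> \<open>One factor 2 comes from the two signs of a root and one from the
    \<open>k / 2\<close> on the right; squaring the 4 gives the 16 below.\<close>
  have c_sum: "(\<Sum>\<alpha>\<in>R. (k (norm \<alpha>) * c \<alpha>) *\<^sub>R \<alpha>) = 4 *\<^sub>R (\<Sum>\<alpha>\<in>P. (k (norm \<alpha>) / 2 * c \<alpha>) *\<^sub>R \<alpha>)"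
    unfolding P_def using odd
    by (subst sum_roots_even[OF R x0]) (auto simp: scaleR_sum_right mult.commute)
  have s_sum: "(\<Sum>\<alpha>\<in>R. (k (norm \<alpha>) * s \<alpha>) *\<^sub>R \<alpha>) = 4 *\<^sub>R (\<Sum>\<alpha>\<in>P. (k (norm \<alpha>) / 2) *\<^sub>R \<alpha>)"
    unfolding P_def using odd
    by (subst sum_roots_even[OF R x0]) (auto simp: scaleR_sum_right s_def)
  have "16 * ((norm (\<Sum>\<alpha>\<in>P. (k (norm \<alpha>) / 2 * c \<alpha>) *\<^sub>R \<alpha>))\<^sup>2 +
      (norm (\<Sum>\<alpha>\<in>P. (k (norm \<alpha>) / 2) *\<^sub>R \<alpha>))\<^sup>2) =
      (norm (\<Sum>\<alpha>\<in>R. (k (norm \<alpha>) * c \<alpha>) *\<^sub>R \<alpha>))\<^sup>2 +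
      (norm (\<Sum>\<alpha>\<in>R. (k (norm \<alpha>) * s \<alpha>) *\<^sub>R \<alpha>))\<^sup>2"
    unfolding c_sum s_sum by (simp add: power_mult_distrib)
  also have "\<dots> = (\<Sum>\<alpha>\<in>R. \<Sum>\<beta>\<in>R. weight \<alpha> \<beta> * h \<alpha> \<beta>)"
    unfolding norm_sum_scaled_squared sum.distrib[symmetric]
    by (intro sum.cong refl) (simp add: weight_def h_def algebra_simps)
  \<comment> \<open>The sum over roots whose double is a root becomes a conditional summand over
    \<open>R\<close>. Its factor 8 meets the 1/2 in \<open>double\<close>, which yields the
    \<open>2 * k (2 * norm \<alpha>)\<close> in \<open>q\<close>.\<close>
  also have "\<dots> = (\<Sum>\<alpha>\<in>R. 2 * q \<alpha>)"
    unfolding sum_all_pairs sum_distrib_left sum.inter_filter[OF \<open>finite R\<close>] sum.distrib[symmetric]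
    by (intro sum.cong refl)
      (auto simp: q_def diag double power2_norm_eq_inner power2_eq_square[of "k _"] ring_distribs
        add_divide_distrib)
  also have "\<dots> = 4 * sum q P"
    unfolding P_def by (subst sum_roots_even[OF R x0]) (auto simp: q_def sum_distrib_left dest: root_neg[OF R])
  finally have eq: "16 * ((norm (\<Sum>\<alpha>\<in>P. (k (norm \<alpha>) / 2 * c \<alpha>) *\<^sub>R \<alpha>))\<^sup>2 +
      (norm (\<Sum>\<alpha>\<in>P. (k (norm \<alpha>) / 2) *\<^sub>R \<alpha>))\<^sup>2) = 4 * sum q P" .
  have cancel: "X = Y / 4" if "16 * X = 4 * Y" for X Y :: real using that by simp
  show ?thesis
    using cancel[OF eq] unfolding sum_divide_distrib c_def q_def
    by (simp only: divide_divide_eq_left mult.commute)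
qed

section \<open>Gradients and Laplacians\<close>

lemma gderiv_unique: "GDERIV f x :> D \<Longrightarrow> GDERIV f x :> E \<Longrightarrow> D = E"
  unfolding gderiv_def
  by (drule (1) has_derivative_unique) (metis inner_commute vector_eq_rdot)

lemma gradient_eq: "GDERIV f x :> D \<Longrightarrow> gradient f x = D"
  unfolding gradient_def by (blast intro: gderiv_unique)

text \<open>The derivative is a linear functional, and the coordinates of its representing vector
  are its values on the orthonormal basis.\<close>

lemma gderiv_differentiable:
  assumes "f differentiable (at x)"
  shows "GDERIV f x :> (\<Sum>b\<in>Basis. frechet_derivative f (at x) b *\<^sub>R b)"
proof -
  have f': "(f has_derivative frechet_derivative f (at x)) (at x)"
    using assms by (simp add: frechet_derivative_works)
  interpret linear "frechet_derivative f (at x)"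
    using f' by (rule has_derivative_linear)
  define D where "D = (\<Sum>b\<in>Basis. frechet_derivative f (at x) b *\<^sub>R b)"
  have "frechet_derivative f (at x) v = v \<bullet> D" for v
  proof -
    have "frechet_derivative f (at x) v = frechet_derivative f (at x) (\<Sum>b\<in>Basis. (v \<bullet> b) *\<^sub>R b)"
      by (simp add: euclidean_representation)
    then show ?thesis by (simp add: D_def sum scale inner_sum_right mult.commute)
  qed
  then have "frechet_derivative f (at x) = (\<lambda>v. v \<bullet> D)" by (rule ext)
  with f' show ?thesis unfolding gderiv_def D_def[symmetric] by simp
qed

lemma laplacian_eq:
  assumes S: "open S" "x \<in> S" and g: "\<And>y. y \<in> S \<Longrightarrow> GDERIV f y :> g y"
    and g': "(g has_derivative g') (at x)"
  shows "laplacian f x = (\<Sum>b\<in>Basis. g' b \<bullet> b)"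
proof -
  have "(gradient f has_derivative g') (at x)"
    by (rule has_derivative_transform_within_open[OF g' S]) (simp add: gradient_eq[OF g])
  then show ?thesis
    unfolding laplacian_def by (simp add: frechet_derivative_at[symmetric])
qed

lemma smooth_gradient:
  assumes S: "open S" "x \<in> S" and \<phi>: "smooth_on \<phi> S"
  shows "GDERIV \<phi> x :> gradient \<phi> x" "gradient \<phi> differentiable (at x)"
proof -
  \<comment> \<open>Two levels of \<open>C_k_on\<close> give differentiability of \<phi> and of its
    derivative in each fixed direction, hence of the gradient coordinates.\<close>
  have C2: "C_k_on (Suc (Suc 0)) \<phi> S" using \<phi> by (simp only: smooth_on_def)
  then have d: "\<phi> differentiable (at y)" if "y \<in> S" for y using that by simp
  have dd: "(\<lambda>y. frechet_derivative \<phi> (at y) v) differentiable (at x)" for v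
    using C2 S(2) by simp
  have grad: "gradient \<phi> y = (\<Sum>b\<in>Basis. frechet_derivative \<phi> (at y) b *\<^sub>R b)" if "y \<in> S" for y
    using gderiv_differentiable[OF d[OF that]] by (rule gradient_eq)
  then show "GDERIV \<phi> x :> gradient \<phi> x"
    using gderiv_differentiable[OF d[OF S(2)]] S(2) by simp
  have "(\<lambda>y. \<Sum>b\<in>Basis. frechet_derivative \<phi> (at y) b *\<^sub>R b) differentiable (at x)"
    using dd by (intro differentiable_sum differentiable_scaleR) auto
  then obtain D where "((\<lambda>y. \<Sum>b\<in>Basis. frechet_derivative \<phi> (at y) b *\<^sub>R b) has_derivative D) (at x)"
    by (auto simp: differentiable_def)
  then have "(gradient \<phi> has_derivative D) (at x)"
    by (rule has_derivative_transform_within_open[OF _ S]) (simp add: grad)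
  then show "gradient \<phi> differentiable (at x)" by (auto simp: differentiable_def)
qed

text \<open>Here \<open>g\<close> is the logarithmic gradient of \<open>F\<close>, so the gradient
  of the product is \<open>F\<close> times the sum of the gradient of \<phi> and \<phi>
  \<open>g\<close>. Differentiating once more and taking the trace produces the mixed term
  twice.\<close>

lemma laplacian_conjugate:
  fixes F \<phi> :: "'a::euclidean_space \<Rightarrow> real"
  assumes S: "open S" "x \<in> S" and F: "\<And>y. y \<in> S \<Longrightarrow> GDERIV F y :> F y *\<^sub>R g y"
    and g: "(g has_derivative g') (at x)" and \<phi>: "smooth_on \<phi> S"
  shows "laplacian (\<lambda>y. F y * \<phi> y) x =
    F x * (laplacian \<phi> x + 2 * (g x \<bullet> gradient \<phi> x) + ((\<Sum>b\<in>Basis. g' b \<bullet> b) + (norm (g x))\<^sup>2) * \<phi> x)"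
proof -
  obtain p' where p': "(gradient \<phi> has_derivative p') (at x)"
    using smooth_gradient(2)[OF S \<phi>] by (auto simp: differentiable_def)
  have \<phi>1: "GDERIV \<phi> y :> gradient \<phi> y" if "y \<in> S" for y
    using smooth_gradient(1)[OF S(1) that \<phi>] .
  have F1: "(F has_derivative (\<lambda>h. h \<bullet> (F x *\<^sub>R g x))) (at x)"
    and \<phi>2: "(\<phi> has_derivative (\<lambda>h. h \<bullet> gradient \<phi> x)) (at x)"
    using F[OF S(2)] \<phi>1[OF S(2)] by (simp_all add: gderiv_def)
  have lap\<phi>: "laplacian \<phi> x = (\<Sum>b\<in>Basis. p' b \<bullet> b)"
    using \<phi>1 p' by (rule laplacian_eq[OF S])
  define D where "D = (\<lambda>y. F y *\<^sub>R (gradient \<phi> y + \<phi> y *\<^sub>R g y))"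
  have D: "GDERIV (\<lambda>y. F y * \<phi> y) y :> D y" if "y \<in> S" for y
    using GDERIV_mult[OF F[OF that] \<phi>1[OF that]]
    by (simp add: D_def algebra_simps)
  define D' where "D' = (\<lambda>h. F x *\<^sub>R (p' h + (\<phi> x *\<^sub>R g' h + (h \<bullet> gradient \<phi> x) *\<^sub>R g x)) +
    (h \<bullet> (F x *\<^sub>R g x)) *\<^sub>R (gradient \<phi> x + \<phi> x *\<^sub>R g x))"
  have "(D has_derivative D') (at x)"
    unfolding D_def D'_def
    by (intro has_derivative_scaleR has_derivative_add p' g F1 \<phi>2)
  then have "laplacian (\<lambda>y. F y * \<phi> y) x = (\<Sum>b\<in>Basis. D' b \<bullet> b)"
    using D by (intro laplacian_eq[OF S])
  also have "\<dots> = (\<Sum>b\<in>Basis. F x * (p' b \<bullet> b + \<phi> x * (g' b \<bullet> b) +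
      2 * ((g x \<bullet> b) * (gradient \<phi> x \<bullet> b)) + \<phi> x * ((g x \<bullet> b) * (g x \<bullet> b))))"
    by (intro sum.cong refl)
      (simp add: D'_def inner_add_left inner_commute algebra_simps)
  also have "\<dots> = F x * ((\<Sum>b\<in>Basis. p' b \<bullet> b) + \<phi> x * (\<Sum>b\<in>Basis. g' b \<bullet> b) +
      2 * (g x \<bullet> gradient \<phi> x) + \<phi> x * (g x \<bullet> g x))"
    unfolding sum_distrib_left[symmetric] sum.distrib euclidean_inner[symmetric]
    by simp
  finally show ?thesis
    by (simp add: lap\<phi> power2_norm_eq_inner algebra_simps)
qed

section \<open>Derivatives of the logarithmic sine and of the cotangent\<close>

lemma has_derivative_half_inner:
  "((\<lambda>v. (\<alpha> \<bullet> v) / 2) has_derivative (\<lambda>h. (\<alpha> \<bullet> h) / 2)) (at u)"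
  by (auto intro!: derivative_eq_intros)

lemma gderiv_ln_abs_sin:
  fixes \<alpha> u :: "'a::euclidean_space"
  assumes "sin ((\<alpha> \<bullet> u) / 2) \<noteq> 0"
  shows "GDERIV (\<lambda>v. ln \<bar>sin ((\<alpha> \<bullet> v) / 2)\<bar>) u :> (cot ((\<alpha> \<bullet> u) / 2) / 2) *\<^sub>R \<alpha>"
proof -
  have pos: "0 < sin ((\<alpha> \<bullet> u) / 2) * sin ((\<alpha> \<bullet> u) / 2)"
    using assms not_real_square_gt_zero by blast
  \<comment> \<open>Replacing the absolute value by half the logarithm of the square avoids a case
    distinction on the sign. Where the sine vanishes the two expressions agree as well, because
    \<open>ln 0 = 0\<close>.\<close>
  have "((\<lambda>x. ln ((sin x)\<^sup>2) / 2) has_real_derivative cot ((\<alpha> \<bullet> u) / 2)) (at ((\<alpha> \<bullet> u) / 2))"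
    using assms by (auto intro!: derivative_eq_intros simp: cot_def power2_eq_square pos)
  moreover have "ln ((sin x)\<^sup>2) / 2 = ln \<bar>sin x\<bar>" for x :: real
    using ln_realpow[of "\<bar>sin x\<bar>" 2] by (cases "sin x = 0") auto
  ultimately have "((\<lambda>x. ln \<bar>sin x\<bar>) has_real_derivative cot ((\<alpha> \<bullet> u) / 2)) (at ((\<alpha> \<bullet> u) / 2))"
    by simp
  from has_derivative_compose[OF has_derivative_half_inner this[unfolded has_field_derivative_def]]
  show ?thesis by (simp add: gderiv_def inner_commute)
qed

lemma has_derivative_cot_half_inner:
  fixes \<alpha> u :: "'a::euclidean_space"
  assumes "sin ((\<alpha> \<bullet> u) / 2) \<noteq> 0"
  shows "((\<lambda>v. cot ((\<alpha> \<bullet> v) / 2)) has_derivative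
    (\<lambda>h. - (\<alpha> \<bullet> h) / (2 * (sin ((\<alpha> \<bullet> u) / 2))\<^sup>2))) (at u)"
proof -
  from has_derivative_compose[OF has_derivative_half_inner
      DERIV_cot[OF assms, unfolded has_field_derivative_def]]
  show ?thesis by (simp add: field_simps)
qed

lemma gderiv_sum:
  "(\<And>i. i \<in> I \<Longrightarrow> GDERIV (f i) x :> D i) \<Longrightarrow> GDERIV (\<lambda>y. \<Sum>i\<in>I. f i y) x :> (\<Sum>i\<in>I. D i)"
  by (auto simp: gderiv_def inner_sum_right intro!: has_derivative_sum)

lemma gderiv_cong_open:
  "\<lbrakk>GDERIV f x :> D; open S; x \<in> S; \<And>y. y \<in> S \<Longrightarrow> f y = g y\<rbrakk> \<Longrightarrow> GDERIV g x :> D"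
  unfolding gderiv_def by (rule has_derivative_transform_within_open)

lemma gderiv_scale: "GDERIV f x :> D \<Longrightarrow> GDERIV (\<lambda>y. c * f y) x :> c *\<^sub>R D"
  by (auto simp: gderiv_def intro!: derivative_eq_intros)

section \<open>Alcove walls, Weyl chambers and grouping by length\<close>

text \<open>The walls belonging to \<alpha> together form the zero set of the continuous function
  \<open>sin ((\<alpha> \<bullet> u) / 2)\<close>, hence a closed set.\<close>

lemma open_complement_walls:
  fixes R :: "'a::euclidean_space set"
  assumes "finite R"
  shows "open (UNIV - (\<Union>\<alpha>\<in>R. {u. \<exists>m::int. \<alpha> \<bullet> u = 2 * pi * of_int m}))"
proof -
  have "{u. \<exists>m::int. \<alpha> \<bullet> u = 2 * pi * of_int m} = {u. sin ((\<alpha> \<bullet> u) / 2) = 0}" for \<alpha> :: 'a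
    by (auto simp: sin_zero_iff_int2 field_simps)
  moreover have "closed {u. sin ((\<alpha> \<bullet> u) / 2) = 0}" for \<alpha> :: 'a
    by (intro closed_Collect_eq continuous_intros) auto
  ultimately show ?thesis using assms by (auto intro!: open_Diff closed_UN)
qed

text \<open>A root has no zero on the connected set \<open>C\<close>, so it keeps its sign there,
  and any single point of \<open>C\<close> decides which roots are positive.\<close>

lemma chamber_positive_roots:
  fixes R C :: "'a::euclidean_space set"
  assumes "weyl_chamber R C"
  obtains x0 where "\<And>\<alpha>. \<alpha> \<in> R \<Longrightarrow> \<alpha> \<bullet> x0 \<noteq> 0" "positive_roots R C = {\<alpha> \<in> R. \<alpha> \<bullet> x0 > 0}"
proof -
  let ?X = "UNIV - (\<Union>\<alpha>\<in>R. {u. \<alpha> \<bullet> u = 0})"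
  have C: "C \<in> components ?X" using assms by (simp add: weyl_chamber_def)
  then have sub: "C \<subseteq> ?X" and con: "connected C" and "C \<noteq> {}"
    by (simp_all add: in_components_subset in_components_connected in_components_nonempty)
  then obtain x0 where x0: "x0 \<in> C" by blast
  have nz: "\<alpha> \<bullet> v \<noteq> 0" if "\<alpha> \<in> R" "v \<in> C" for \<alpha> v using that sub by auto
  have "\<alpha> \<bullet> v > 0" if \<alpha>: "\<alpha> \<in> R" "\<alpha> \<bullet> x0 > 0" and v: "v \<in> C" for \<alpha> v
  proof (rule ccontr)
    assume "\<not> \<alpha> \<bullet> v > 0"
    moreover have "connected ((\<lambda>w. \<alpha> \<bullet> w) ` C)"
      by (intro connected_continuous_image continuous_intros con)
    ultimately have "0 \<in> (\<lambda>w. \<alpha> \<bullet> w) ` C"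
      using connectedD_interval[of "(\<lambda>w. \<alpha> \<bullet> w) ` C" "\<alpha> \<bullet> v" "\<alpha> \<bullet> x0" 0] \<alpha>(2) v x0
      by auto
    then show False using nz[OF \<alpha>(1)] by auto
  qed
  with x0 have "positive_roots R C = {\<alpha> \<in> R. \<alpha> \<bullet> x0 > 0}" by (auto simp: positive_roots_def)
  with nz x0 that show thesis by metis
qed

lemma sum_over_lengths:
  fixes R C :: "'a::euclidean_space set" and f :: "'a \<Rightarrow> 'b::comm_monoid_add"
  assumes "finite R"
  shows "(\<Sum>c\<in>root_lengths R. \<Sum>\<alpha>\<in>positive_roots_of_length R C c. f \<alpha>) = sum f (positive_roots R C)"
  unfolding positive_roots_of_length_def root_lengths_def
  using assms by (intro sum.group) (auto simp: positive_roots_def)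

section \<open>The conjugation identity on the alcove\<close>

theorem proposition16:
  fixes R C A :: "'a::euclidean_space set"
    and k a :: "real \<Rightarrow> real"
    and \<phi> :: "'a \<Rightarrow> real"
  assumes "root_system R"
    and "irreducible_roots R"
    and "weyl_chamber R C"
    and "fundamental_alcove R C A"
    and "\<And>\<alpha>. non_multiplicable R \<alpha> \<Longrightarrow> a (norm \<alpha>) = k (norm \<alpha>) * (k (norm \<alpha>) - 1)"
    and "\<And>c. \<not> reduced_roots R \<Longrightarrow> c = short_length R \<Longrightarrow> a c = k c * (k c + 2 * k (2 * c) - 1)"
    and "smooth_on \<phi> A"
  shows "\<forall>u\<in>A. F_fun R C k u * H_tilde_op R C k \<phi> u =
           H_op R C a (\<lambda>v. F_fun R C k v * \<phi> v) u - (norm (rho R C k))\<^sup>2 * (F_fun R C k u * \<phi> u)"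
proof
  fix u assume u: "u \<in> A"
  define P where "P = positive_roots R C"
  \<comment> \<open>\<open>g\<close> is the gradient of the logarithm of \<open>F\<close>, and
    \<open>g'\<close> is its derivative at \<open>u\<close>.\<close>
  define g where "g = (\<lambda>v. \<Sum>\<alpha>\<in>P. (k (norm \<alpha>) / 2 * cot ((\<alpha> \<bullet> v) / 2)) *\<^sub>R \<alpha>)"
  define g' where "g' = (\<lambda>h. \<Sum>\<alpha>\<in>P. (k (norm \<alpha>) / 2 * (- (\<alpha> \<bullet> h) / (2 * (sin ((\<alpha> \<bullet> u) / 2))\<^sup>2))) *\<^sub>R \<alpha>)"
  have fin: "finite R" using assms(1) by (simp add: root_system_def)
  then have finP: "finite P" and PR: "P \<subseteq> R" by (auto simp: P_def positive_roots_def)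
  have finPc: "finite (positive_roots_of_length R C c)" and PcR: "positive_roots_of_length R C c \<subseteq> R" for c
    using fin by (auto simp: positive_roots_def positive_roots_of_length_def)
  obtain x0 where x0: "\<And>\<alpha>. \<alpha> \<in> R \<Longrightarrow> \<alpha> \<bullet> x0 \<noteq> 0" "P = {\<alpha> \<in> R. \<alpha> \<bullet> x0 > 0}"
    using chamber_positive_roots[OF assms(3)] unfolding P_def by blast
  have A: "A \<in> components (UNIV - (\<Union>\<alpha>\<in>R. {u. \<exists>m::int. \<alpha> \<bullet> u = 2 * pi * of_int m}))"
    using assms(4) by (simp add: fundamental_alcove_def)
  have opA: "open A"
    using open_components[OF open_complement_walls[OF fin] A] .
  have sin_nz: "sin ((\<alpha> \<bullet> v) / 2) \<noteq> 0" if "\<alpha> \<in> R" "v \<in> A" for \<alpha> v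
    using in_components_subset[OF A] that by (auto simp: sin_zero_iff_int2 field_simps)
  have A_nz: "A_fun R C c v \<noteq> 0" if "v \<in> A" for c v
    using sin_nz[OF _ that] finPc[of c] PcR[of c] by (auto simp: A_fun_def)
  have ln_A: "ln \<bar>A_fun R C c v\<bar> = (\<Sum>\<alpha>\<in>positive_roots_of_length R C c. ln \<bar>sin ((\<alpha> \<bullet> v) / 2)\<bar>)"
    if "v \<in> A" for c v
    unfolding A_fun_def abs_prod
    using sin_nz[OF _ that] finPc[of c] PcR[of c] by (intro ln_prod) auto
  have grad_A: "GDERIV (\<lambda>v. ln \<bar>A_fun R C c v\<bar>) v :>
      (\<Sum>\<alpha>\<in>positive_roots_of_length R C c. (cot ((\<alpha> \<bullet> v) / 2) / 2) *\<^sub>R \<alpha>)" if "v \<in> A" for c v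
    using sin_nz[OF _ that] PcR[of c] ln_A
    by (intro gderiv_cong_open[OF gderiv_sum[OF gderiv_ln_abs_sin] opA that]) auto
  \<comment> \<open>Used with cotangent values for \<open>f\<close> to obtain \<open>g\<close>, and
    with the constant 1 to obtain \<open>rho\<close>.\<close>
  have weighted: "(\<Sum>c\<in>root_lengths R. k c *\<^sub>R (\<Sum>\<alpha>\<in>positive_roots_of_length R C c. (f \<alpha> / 2) *\<^sub>R \<alpha>)) =
      (\<Sum>\<alpha>\<in>P. (k (norm \<alpha>) / 2 * f \<alpha>) *\<^sub>R \<alpha>)" for f
    unfolding P_def sum_over_lengths[OF fin, symmetric] scaleR_sum_right
    by (intro sum.cong refl) (auto simp: positive_roots_of_length_def)
  have F_exp: "F_fun R C k v = exp (\<Sum>c\<in>root_lengths R. k c * ln \<bar>A_fun R C c v\<bar>)" if "v \<in> A" for v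
    using A_nz[OF that] fin by (simp add: F_fun_def powr_def exp_sum root_lengths_def)
  have gF: "GDERIV (F_fun R C k) v :> F_fun R C k v *\<^sub>R g v" if "v \<in> A" for v
  proof -
    have "GDERIV (\<lambda>v. \<Sum>c\<in>root_lengths R. k c * ln \<bar>A_fun R C c v\<bar>) v :> g v"
      unfolding g_def weighted[symmetric]
      by (intro gderiv_sum gderiv_scale grad_A that)
    from GDERIV_DERIV_compose[OF this DERIV_exp]
    show ?thesis unfolding F_exp[OF that]
      by (rule gderiv_cong_open[OF _ opA that]) (simp add: F_exp)
  qed
  have g': "(g has_derivative g') (at u)"
    unfolding g_def g'_def using sin_nz[OF _ u] PR
    by (intro has_derivative_sum has_derivative_scaleR_left has_derivative_mult_right
        has_derivative_cot_half_inner) auto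
  \<comment> \<open>Each summand of \<open>g'\<close> is a multiple of the map sending
    \<open>h\<close> to \<open>(\<alpha> \<bullet> h) *\<^sub>R \<alpha>\<close>, whose trace is the
    squared norm of \<alpha>.\<close>
  have div_g: "(\<Sum>b\<in>Basis. g' b \<bullet> b) =
      - (\<Sum>\<alpha>\<in>P. k (norm \<alpha>) * (norm \<alpha>)\<^sup>2 / 4 / (sin ((\<alpha> \<bullet> u) / 2))\<^sup>2)"
  proof -
    have "(\<Sum>b\<in>Basis. g' b \<bullet> b) = (\<Sum>\<alpha>\<in>P. \<Sum>b\<in>Basis.
        - k (norm \<alpha>) / 4 / (sin ((\<alpha> \<bullet> u) / 2))\<^sup>2 * ((\<alpha> \<bullet> b) * (\<alpha> \<bullet> b)))"
      unfolding g'_def inner_sum_left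
      by (subst sum.swap) (simp add: mult_ac)
    also have "\<dots> = (\<Sum>\<alpha>\<in>P. - (k (norm \<alpha>) * (norm \<alpha>)\<^sup>2 / 4 / (sin ((\<alpha> \<bullet> u) / 2))\<^sup>2))"
      unfolding sum_distrib_left[symmetric] euclidean_inner[symmetric] power2_norm_eq_inner
      by simp
    finally show ?thesis by (simp add: sum_negf)
  qed
  have rho: "rho R C k = (\<Sum>\<alpha>\<in>P. (k (norm \<alpha>) / 2) *\<^sub>R \<alpha>)"
    using weighted[of "\<lambda>_. 1"] by (simp add: rho_def rho_length_def scaleR_sum_right)
  \<comment> \<open>Both cases of the coupling constant are split alike: the product is the
    coefficient in \<open>drift_identity\<close>, and the subtracted
    \<open>k (norm \<alpha>)\<close> is the coefficient in the divergence of
    \<open>g\<close>.\<close>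
  have coupling: "a (norm \<alpha>) =
      k (norm \<alpha>) * (k (norm \<alpha>) + (if 2 *\<^sub>R \<alpha> \<in> R then 2 * k (2 * norm \<alpha>) else 0)) - k (norm \<alpha>)"
    if "\<alpha> \<in> P" for \<alpha>
  proof (cases "2 *\<^sub>R \<alpha> \<in> R")
    case True
    have "\<alpha> \<in> R" "\<alpha> \<noteq> 0" using that PR assms(1) by (auto simp: root_system_def)
    have "\<not> reduced_roots R"
    proof
      assume "reduced_roots R"
      then have "2 *\<^sub>R \<alpha> = \<alpha> \<or> 2 *\<^sub>R \<alpha> = - \<alpha>"
        using True \<open>\<alpha> \<in> R\<close> unfolding reduced_roots_def by blast
      then have "2 * (\<alpha> \<bullet> \<alpha>) = \<alpha> \<bullet> \<alpha> \<or> 2 * (\<alpha> \<bullet> \<alpha>) = - (\<alpha> \<bullet> \<alpha>)"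
        by (metis inner_scaleR_left inner_minus_left)
      with \<open>\<alpha> \<noteq> 0\<close> show False by simp
    qed
    \<comment> \<open>A root whose double is a root has the least length, which is where the
      non-reduced formula for \<open>a\<close> is given.\<close>
    then have "a (norm \<alpha>) = k (norm \<alpha>) * (k (norm \<alpha>) + 2 * k (2 * norm \<alpha>) - 1)"
      using assms(6) multiplicable_root_shortest[OF assms(1,2) \<open>\<alpha> \<in> R\<close> True] by blast
    then show ?thesis using True by (simp add: algebra_simps)
  next
    case False
    then have "a (norm \<alpha>) = k (norm \<alpha>) * (k (norm \<alpha>) - 1)"
      using that PR assms(5) by (auto simp: non_multiplicable_def)
    then show ?thesis using False by (simp add: algebra_simps)
  qed
  have potential: "(\<Sum>c\<in>root_lengths R. a c * U_fun R C c u) =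
      (\<Sum>\<alpha>\<in>P. a (norm \<alpha>) * (norm \<alpha>)\<^sup>2 / 4 / (sin ((\<alpha> \<bullet> u) / 2))\<^sup>2)"
    unfolding P_def sum_over_lengths[OF fin, symmetric] U_fun_def sum_distrib_left
    by (intro sum.cong refl) (auto simp: positive_roots_of_length_def)
  have "(norm (g u))\<^sup>2 + (norm (rho R C k))\<^sup>2 = (\<Sum>\<alpha>\<in>P.
      k (norm \<alpha>) * (k (norm \<alpha>) + (if 2 *\<^sub>R \<alpha> \<in> R then 2 * k (2 * norm \<alpha>) else 0)) *
      (norm \<alpha>)\<^sup>2 / 4 / (sin ((\<alpha> \<bullet> u) / 2))\<^sup>2)"
    unfolding g_def rho x0(2)
    using drift_identity[OF assms(1) x0(1) sin_nz[OF _ u]] .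
  also have "\<dots> + (\<Sum>b\<in>Basis. g' b \<bullet> b) = (\<Sum>c\<in>root_lengths R. a c * U_fun R C c u)"
    unfolding potential div_g diff_conv_add_uminus[symmetric] sum_subtractf[symmetric]
    by (intro sum.cong refl) (simp only: coupling left_diff_distrib diff_divide_distrib)
  finally have key: "(\<Sum>b\<in>Basis. g' b \<bullet> b) + (norm (g u))\<^sup>2 =
      (\<Sum>c\<in>root_lengths R. a c * U_fun R C c u) - (norm (rho R C k))\<^sup>2" by simp
  have drift: "(\<Sum>c\<in>root_lengths R.
      2 * k c * (gradient (\<lambda>v. ln \<bar>A_fun R C c v\<bar>) u \<bullet> gradient \<phi> u)) = 2 * (g u \<bullet> gradient \<phi> u)"
    unfolding g_def weighted[symmetric] gradient_eq[OF grad_A[OF u]]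
    by (simp add: inner_sum_left sum_distrib_left mult.assoc)
  have lap: "laplacian (\<lambda>v. F_fun R C k v * \<phi> v) u = F_fun R C k u * (laplacian \<phi> u +
      2 * (g u \<bullet> gradient \<phi> u) +
      ((\<Sum>c\<in>root_lengths R. a c * U_fun R C c u) - (norm (rho R C k))\<^sup>2) * \<phi> u)"
    unfolding key[symmetric] using gF by (rule laplacian_conjugate[OF opA u _ g' assms(7)])
  show "F_fun R C k u * H_tilde_op R C k \<phi> u =
      H_op R C a (\<lambda>v. F_fun R C k v * \<phi> v) u - (norm (rho R C k))\<^sup>2 * (F_fun R C k u * \<phi> u)"
    unfolding H_tilde_op_def H_op_def drift lap
    by (simp add: algebra_simps)
qed

end
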